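(* Let $\kappa$ be an infinite cardinal, assume $\mathrm{MA}_\kappa$, and let $\mathcal{I}$ be an everywhere meager ideal on $\omega$. Then every $\mathcal{H}\subseteq\mathcal{I}^+$ with $|\mathcal{H}|\leq\kappa$ has an $(\mathcal{I},\mathrm{Fin})$-ADR; that is, there is a family $\{A_H:H\in\mathcal{H}\}$ such that (i) $A_H\subseteq H$ and $A_H\in\mathcal{I}^+$ for every $H\in\mathcal{H}$, and (ii) $|A_{H_0}\cap A_{H_1}|<\omega$ for every distinct $H_0,H_1\in\mathcal{H}$.
   Context: An ideal $\mathcal{I}$ on a countably infinite set $X$ is always assumed to satisfy $[X]^{<\omega}\subseteq\mathcal{I}$ and $X\notin\mathcal{I}$; $\mathcal{I}^+=\mathcal{P}(X)\setminus\mathcal{I}$. For $Y\in\mathcal{I}^+$, $\mathcal{I}\upharpoonright Y=\{A\in\mathcal{I}:A\subseteq Y\}$. $\mathcal{I}$ is everywhere meager if $\mathcal{I}\upharpoonright Y$ is meager in $\mathcal{P}(Y)\simeq 2^Y$ for every $Y\in\mathcal{I}^+$. $\mathrm{MA}_\kappa$ (Martin's Axiom for $\kappa$): for every nonempty ccc poset $\mathbb{P}$ and every family $\mathcal{D}$ of at most $\kappa$ many dense subsets of $\mathbb{P}$ there is a filter on $\mathbb{P}$ meeting every element of $\mathcal{D}$. *)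

theory Defs
  imports "HOL-Analysis.Analysis"
begin

unbundle cardinal_syntax

definition ideal_on :: "'a set \<Rightarrow> 'a set set \<Rightarrow> bool" where
  "ideal_on X I \<longleftrightarrow>
     I \<subseteq> Pow X \<and>
     (\<forall>A\<in>I. \<forall>B. B \<subseteq> A \<longrightarrow> B \<in> I) \<and>
     (\<forall>A\<in>I. \<forall>B\<in>I. A \<union> B \<in> I) \<and>
     (\<forall>F. finite F \<and> F \<subseteq> X \<longrightarrow> F \<in> I) \<and>
     X \<notin> I"

definition positive_sets :: "'a set \<Rightarrow> 'a set set \<Rightarrow> 'a set set" where
  "positive_sets X I = Pow X - I"

definition restrict_ideal :: "'a set set \<Rightarrow> 'a set \<Rightarrow> 'a set set" where
  "restrict_ideal I Y = {A \<in> I. A \<subseteq> Y}"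

definition nowhere_dense_in :: "'a topology \<Rightarrow> 'a set \<Rightarrow> bool" where
  "nowhere_dense_in T S \<longleftrightarrow> S \<subseteq> topspace T \<and> T interior_of (T closure_of S) = {}"

definition meager_in :: "'a topology \<Rightarrow> 'a set \<Rightarrow> bool" where
  "meager_in T S \<longleftrightarrow> (\<exists>N :: nat \<Rightarrow> 'a set. (\<forall>n. nowhere_dense_in T (N n)) \<and> S = (\<Union>n. N n))"

text \<open>The topology on the power set of \<open>Y\<close> transported from the product space of functions
  \<open>Y \<rightarrow> bool\<close> (with \<open>bool\<close> discrete) along the bijection sending a subset to its
  characteristic function. Points of the product topology are extensional on \<open>Y\<close>, whence
  the restriction.\<close>

definition powerset_topology :: "'a set \<Rightarrow> 'a set topology" where
  "powerset_topology Y =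
     pullback_topology (Pow Y) (\<lambda>A. restrict (\<lambda>y. y \<in> A) Y)
       (product_topology (\<lambda>_. discrete_topology (UNIV :: bool set)) Y)"

definition everywhere_meager :: "'a set \<Rightarrow> 'a set set \<Rightarrow> bool" where
  "everywhere_meager X I \<longleftrightarrow>
     (\<forall>Y\<in>positive_sets X I. meager_in (powerset_topology Y) (restrict_ideal I Y))"

text \<open>A poset is a carrier \<open>P\<close> with a relation \<open>r\<close>; \<open>(p, q) \<in> r\<close> reads
  \<open>p \<le> q\<close>, i.e. \<open>p\<close> is the stronger condition.\<close>

definition compatible_in :: "'p set \<Rightarrow> 'p rel \<Rightarrow> 'p \<Rightarrow> 'p \<Rightarrow> bool" where
  "compatible_in P r p q \<longleftrightarrow> (\<exists>s\<in>P. (s, p) \<in> r \<and> (s, q) \<in> r)"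

definition forcing_antichain :: "'p set \<Rightarrow> 'p rel \<Rightarrow> 'p set \<Rightarrow> bool" where
  "forcing_antichain P r A \<longleftrightarrow>
     A \<subseteq> P \<and> (\<forall>p\<in>A. \<forall>q\<in>A. p \<noteq> q \<longrightarrow> \<not> compatible_in P r p q)"

definition ccc :: "'p set \<Rightarrow> 'p rel \<Rightarrow> bool" where
  "ccc P r \<longleftrightarrow> (\<forall>A. forcing_antichain P r A \<longrightarrow> countable A)"

definition dense_subset :: "'p set \<Rightarrow> 'p rel \<Rightarrow> 'p set \<Rightarrow> bool" where
  "dense_subset P r D \<longleftrightarrow> D \<subseteq> P \<and> (\<forall>p\<in>P. \<exists>d\<in>D. (d, p) \<in> r)"

definition filter_on :: "'p set \<Rightarrow> 'p rel \<Rightarrow> 'p set \<Rightarrow> bool" where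
  "filter_on P r G \<longleftrightarrow>
     G \<subseteq> P \<and> G \<noteq> {} \<and>
     (\<forall>p\<in>G. \<forall>q\<in>P. (p, q) \<in> r \<longrightarrow> q \<in> G) \<and>
     (\<forall>p\<in>G. \<forall>q\<in>G. \<exists>s\<in>G. (s, p) \<in> r \<and> (s, q) \<in> r)"

text \<open>The cardinal \<open>\<kappa>\<close> is represented by a cardinal order on a subset of a type
  \<open>'k\<close>. HOL cannot quantify over all types, so the posets are those with carrier in
  \<open>'k\<close>. This type has at least \<open>\<kappa>\<close> elements, so every poset of size at most
  \<open>\<kappa>\<close> has an isomorphic copy among them, and larger posets are included as far as
  \<open>'k\<close> has room for them. The axiom over all posets therefore implies this form.\<close>

definition martins_axiom :: "'k rel \<Rightarrow> bool" where
  "martins_axiom \<kappa> \<longleftrightarrow>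
     (\<forall>(P :: 'k set) r \<D>.
        P \<noteq> {} \<and> partial_order_on P r \<and> ccc P r \<and>
        (\<forall>D\<in>\<D>. dense_subset P r D) \<and> |\<D>| \<le>o \<kappa> \<longrightarrow>
        (\<exists>G. filter_on P r G \<and> (\<forall>D\<in>\<D>. G \<inter> D \<noteq> {})))"

definition Fin_ADR :: "'a set \<Rightarrow> 'a set set \<Rightarrow> 'a set set \<Rightarrow> ('a set \<Rightarrow> 'a set) \<Rightarrow> bool" where
  "Fin_ADR X I \<H> A \<longleftrightarrow>
     (\<forall>H\<in>\<H>. A H \<subseteq> H \<and> A H \<in> positive_sets X I) \<and>
     (\<forall>H\<^sub>0\<in>\<H>. \<forall>H\<^sub>1\<in>\<H>. H\<^sub>0 \<noteq> H\<^sub>1 \<longrightarrow> finite (A H\<^sub>0 \<inter> A H\<^sub>1))"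

end

theory Submission
  imports Defs "HOL-Algebra.Free_Abelian_Groups"
begin

text \<open>Since \<open>I\<close> is meager below \<open>H\<close>, there are pairwise disjoint finite sets
  \<open>F H n \<subseteq> H\<close> such that every subset of \<open>H\<close> containing infinitely many of them is positive.
  It therefore suffices to choose infinite sets \<open>S H\<close> for which the unions
  \<open>\<Union>n\<in>S H. F H n\<close> are almost disjoint. Finite approximations to \<open>S\<close>, ordered so that the sets
  already mentioned acquire no new common points, form a ccc poset: two conditions that agree on
  their common domain are compatible. There are at most \<open>\<kappa>\<close> conditions, so the poset has a copy on
  a subset of \<open>'k\<close>.\<close>

section \<open>Meager ideals\<close>

lemma topspace_powerset_topology: "topspace (powerset_topology Y) = Pow Y"
  by (auto simp: powerset_topology_def topspace_pullback_topology)

text \<open>A basic open set of the product restricts only finitely many coordinates, so a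
  neighbourhood of \<open>A\<close> can be read off its trace on a finite set \<open>D\<close>.
  After this, function spaces no longer appear in the topological arguments.\<close>

lemma openin_powerset_topology_iff:
  "openin (powerset_topology Y) U \<longleftrightarrow>
     U \<subseteq> Pow Y \<and> (\<forall>A\<in>U. \<exists>D. finite D \<and> D \<subseteq> Y \<and> (\<forall>B\<subseteq>Y. B \<inter> D = A \<inter> D \<longrightarrow> B \<in> U))"
  (is "?L \<longleftrightarrow> ?R")
proof
  let ?f = "\<lambda>A. restrict (\<lambda>y. y \<in> A) Y"
  let ?T = "product_topology (\<lambda>_. discrete_topology (UNIV :: bool set)) Y"
  assume ?L
  then obtain V where V: "openin ?T V" "U = ?f -` V \<inter> Pow Y"
    by (auto simp: powerset_topology_def openin_pullback_topology)
  have "\<exists>D. finite D \<and> D \<subseteq> Y \<and> (\<forall>B\<subseteq>Y. B \<inter> D = A \<inter> D \<longrightarrow> B \<in> U)" if "A \<in> U" for A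
  proof -
    have "?f A \<in> V" using that V by auto
    then obtain W where W: "finite {i\<in>Y. W i \<noteq> UNIV}" "?f A \<in> Pi\<^sub>E Y W" "Pi\<^sub>E Y W \<subseteq> V"
      using V(1) by (force simp: openin_product_topology_alt)
    have "B \<in> U" if "B \<subseteq> Y" and eq: "B \<inter> {i\<in>Y. W i \<noteq> UNIV} = A \<inter> {i\<in>Y. W i \<noteq> UNIV}" for B
    proof -
      have "?f B i \<in> W i" if "i \<in> Y" for i
      proof (cases "W i = UNIV")
        case False
        then have "i \<in> B \<longleftrightarrow> i \<in> A" using eq that by blast
        moreover have "?f A i \<in> W i" using W(2) that by blast
        ultimately show ?thesis using that by simp
      qed simp
      then have "?f B \<in> Pi\<^sub>E Y W" by (intro PiE_I) auto
      then have "?f B \<in> V" using W(3) by blast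
      then show ?thesis using V(2) that(1) by simp
    qed
    then show ?thesis using W(1) by (intro exI[of _ "{i\<in>Y. W i \<noteq> UNIV}"]) auto
  qed
  then show ?R using V by auto
next
  let ?f = "\<lambda>A. restrict (\<lambda>y. y \<in> A) Y"
  let ?T = "product_topology (\<lambda>_. discrete_topology (UNIV :: bool set)) Y"
  assume R: ?R
  \<comment> \<open>\<open>S\<close> consists of the extensional characteristic functions of members
    of \<open>U\<close>. Its preimage under \<open>?f\<close> is \<open>U\<close>, so openness of
    \<open>S\<close> suffices.\<close>
  define S where "S = {g \<in> Pi\<^sub>E Y (\<lambda>_. UNIV). {y\<in>Y. g y} \<in> U}"
  have "openin ?T S"
    unfolding S_def openin_product_topology_alt
  proof safe
    fix g assume g: "g \<in> Pi\<^sub>E Y (\<lambda>_. UNIV :: bool set)" "{y\<in>Y. g y} \<in> U"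
    then obtain D where D: "finite D" "D \<subseteq> Y"
      "\<And>B. B \<subseteq> Y \<Longrightarrow> B \<inter> D = {y\<in>Y. g y} \<inter> D \<Longrightarrow> B \<in> U" using R by meson
    have "h \<in> {g \<in> Pi\<^sub>E Y (\<lambda>_. UNIV). {y\<in>Y. g y} \<in> U}"
      if h: "h \<in> Pi\<^sub>E Y (\<lambda>i. if i \<in> D then {g i} else UNIV)" for h
    proof -
      have "h i = g i" if "i \<in> D" for i
        using h that D(2) PiE_mem[OF h, of i] by auto
      then have "{y\<in>Y. h y} \<inter> D = {y\<in>Y. g y} \<inter> D" by auto
      then show ?thesis using h D(3)[of "{y\<in>Y. h y}"] by (auto simp: PiE_def)
    qed
    then show "\<exists>W. finite {i \<in> Y. W i \<noteq> topspace (discrete_topology (UNIV :: bool set))} \<and>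
        (\<forall>i\<in>Y. openin (discrete_topology UNIV) (W i)) \<and> g \<in> Pi\<^sub>E Y W \<and>
        Pi\<^sub>E Y W \<subseteq> {g \<in> Pi\<^sub>E Y (\<lambda>_. UNIV). {y\<in>Y. g y} \<in> U}"
      using D(1) g(1)
      by (intro exI[of _ "\<lambda>i. if i \<in> D then {g i} else UNIV"])
        (auto simp: PiE_def intro: rev_finite_subset[of D] split: if_splits)
  qed
  moreover have "U = ?f -` S \<inter> Pow Y"
  proof -
    have "{y \<in> Y. restrict (\<lambda>y. y \<in> A) Y y} = A" if "A \<subseteq> Y" for A using that by auto
    then have "?f A \<in> S \<longleftrightarrow> A \<in> U" if "A \<subseteq> Y" for A
      using that by (simp only: S_def mem_Collect_eq restrict_PiE_iff) simp
    moreover have "U \<subseteq> Pow Y" using R ..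
    ultimately show ?thesis by (auto simp del: restrict_apply)
  qed
  ultimately show ?L
    unfolding powerset_topology_def openin_pullback_topology by (intro exI conjI)
qed

text \<open>The sets with trace \<open>d\<close> on \<open>D\<close> form a nonempty open set, which
  cannot lie inside the closure of \<open>N\<close>. A point outside the closure has a basic
  neighbourhood missing \<open>N\<close>, and its trace on the enlarged domain is
  \<open>d'\<close>.\<close>

lemma nowhere_dense_powerset_extend:
  assumes "nowhere_dense_in (powerset_topology Y) N" and "finite D" "D \<subseteq> Y" "d \<subseteq> D"
  obtains D' d' where "finite D'" "D \<subseteq> D'" "D' \<subseteq> Y" "d' \<subseteq> D'" "d' \<inter> D = d"
    "\<And>A. A \<in> N \<Longrightarrow> A \<inter> D' \<noteq> d'"
proof -
  let ?T = "powerset_topology Y"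
  let ?U = "{A. A \<subseteq> Y \<and> A \<inter> D = d}"
  have N: "N \<subseteq> Pow Y" "?T interior_of (?T closure_of N) = {}"
    using assms(1) by (auto simp: nowhere_dense_in_def topspace_powerset_topology)
  have "openin ?T ?U"
    unfolding openin_powerset_topology_iff using assms(2,3) by auto
  moreover have "d \<in> ?U" using assms by auto
  ultimately have "\<not> ?U \<subseteq> ?T closure_of N"
    using N(2) interior_of_maximal[of ?U "?T closure_of N" ?T] by auto
  then obtain A0 where A0: "A0 \<subseteq> Y" "A0 \<inter> D = d" "A0 \<notin> ?T closure_of N" by auto
  then obtain V where V: "openin ?T V" "A0 \<in> V" "V \<inter> N = {}"
    by (auto simp: in_closure_of topspace_powerset_topology)
  then obtain E where E: "finite E" "E \<subseteq> Y" "\<And>B. B \<subseteq> Y \<Longrightarrow> B \<inter> E = A0 \<inter> E \<Longrightarrow> B \<in> V"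
    unfolding openin_powerset_topology_iff by meson
  have "A \<inter> (D \<union> E) \<noteq> A0 \<inter> (D \<union> E)" if "A \<in> N" for A
  proof
    assume "A \<inter> (D \<union> E) = A0 \<inter> (D \<union> E)"
    then have "A \<inter> E = A0 \<inter> E" by blast
    then show False using E(3)[of A] N(1) V(3) that by blast
  qed
  then show thesis
    using that[of "D \<union> E" "A0 \<inter> (D \<union> E)"] assms A0 E by auto
qed

text \<open>The tasks \<open>(k, e)\<close> are met one at a time. The window only grows and its
  pattern is only extended, so tasks met earlier remain met.\<close>

lemma nowhere_dense_powerset_window:
  assumes nd: "\<And>k. nowhere_dense_in (powerset_topology Y) (N k)" and E: "finite E" "E \<subseteq> Y"
    and T: "finite T" "T \<subseteq> UNIV \<times> Pow E"
  shows "\<exists>W s. finite W \<and> W \<subseteq> Y \<and> W \<inter> E = {} \<and> s \<subseteq> W \<and>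
           (\<forall>(k, e)\<in>T. \<forall>A\<in>N k. A \<inter> E = e \<longrightarrow> A \<inter> W \<noteq> s)"
  using T
proof (induction T)
  case empty
  show ?case by (intro exI[of _ "{}"]) auto
next
  case (insert t T)
  have "T \<subseteq> UNIV \<times> Pow E" using insert.prems by blast
  from insert.IH[OF this]
  obtain W s where W: "finite W" "W \<subseteq> Y" "W \<inter> E = {}" "s \<subseteq> W"
    and T: "\<forall>(k, e)\<in>T. \<forall>A\<in>N k. A \<inter> E = e \<longrightarrow> A \<inter> W \<noteq> s"
    by (elim exE conjE) (rule that)
  obtain k e where t: "t = (k, e)" by force
  have e: "e \<subseteq> E" using insert.prems t by auto
  have fD: "finite (E \<union> W)" "E \<union> W \<subseteq> Y" "e \<union> s \<subseteq> E \<union> W" using E W e by auto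
  \<comment> \<open>The new task fixes the trace \<open>e\<close> on \<open>E\<close>, so the
    extension starts from \<open>e \<union> s\<close>. Removing \<open>E\<close> afterwards keeps
    the window disjoint from \<open>E\<close>.\<close>
  obtain D d where D: "finite D" "E \<union> W \<subseteq> D" "D \<subseteq> Y" "d \<subseteq> D" "d \<inter> (E \<union> W) = e \<union> s"
    "\<And>A. A \<in> N k \<Longrightarrow> A \<inter> D \<noteq> d"
    using nowhere_dense_powerset_extend[OF nd[of k] fD] by metis
  have "d \<inter> E = e" "d \<inter> W = s" using D(5) W(3,4) e by blast+
  have "A \<inter> (D - E) \<noteq> d - E" if "(k', e') \<in> insert t T" "A \<in> N k'" "A \<inter> E = e'" for k' e' A
  proof
    assume eq: "A \<inter> (D - E) = d - E"
    show False
    proof (cases "(k', e') \<in> T")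
      case True
      have "A \<inter> W = A \<inter> (D - E) \<inter> W" using D(2) W(3) by blast
      also have "\<dots> = s" using eq \<open>d \<inter> W = s\<close> W(3) by auto
      finally show False using T True that by auto
    next
      case False
      then have "k' = k" "e' = e" using that t by auto
      then have "A \<inter> D = d" using eq that(3) \<open>d \<inter> E = e\<close> D(2,4) by blast
      then show False using D(6) that \<open>k' = k\<close> by blast
    qed
  qed
  then show ?case
    using D by (intro exI[of _ "D - E"] exI[of _ "d - E"]) auto
qed

text \<open>One half of the Jalali-Naini--Talagrand characterisation of meager ideals. If the nowhere
  dense sets \<open>N k\<close> cover the ideal, choose disjoint windows \<open>V n\<close> with patterns \<open>F n \<subseteq> V n\<close> so
  that no set with pattern \<open>F n\<close> on \<open>V n\<close> lies in \<open>N k\<close> for \<open>k \<le> n\<close>. A set containing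
  infinitely many \<open>F n\<close> has a subset with exactly these patterns, which lies in no \<open>N k\<close>.\<close>

lemma meager_ideal_disjoint_finite_sets:
  assumes I: "ideal_on X I" and mea: "meager_in (powerset_topology Y) (restrict_ideal I Y)"
  obtains F :: "nat \<Rightarrow> 'a set" where "\<And>n. finite (F n)" "\<And>n. F n \<subseteq> Y" "disjoint_family F"
    "\<And>A. A \<subseteq> Y \<Longrightarrow> infinite {n. F n \<subseteq> A} \<Longrightarrow> A \<notin> I"
proof -
  obtain N where nd: "\<And>n::nat. nowhere_dense_in (powerset_topology Y) (N n)"
    and IN: "restrict_ideal I Y = (\<Union>n. N n)"
    using mea unfolding meager_in_def by blast
  \<comment> \<open>Each stage deals with finitely many \<open>N k\<close>, yet every
    \<open>N k\<close> is dealt with at all stages \<open>n \<ge> k\<close>.\<close>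
  define good where "good n E W s \<longleftrightarrow> finite W \<and> W \<subseteq> Y \<and> W \<inter> E = {} \<and> s \<subseteq> W \<and>
    (\<forall>k\<le>n. \<forall>A\<in>N k. A \<inter> W \<noteq> s)" for n :: nat and E W s
  have "\<exists>W s. good n E W s" if E: "finite E" "E \<subseteq> Y" for n E
  proof -
    \<comment> \<open>Running through every possible trace \<open>e\<close> on \<open>E\<close>
      makes the resulting pattern work independently of the trace.\<close>
    have "finite ({..n} \<times> Pow E)" "{..n} \<times> Pow E \<subseteq> UNIV \<times> Pow E" using E by auto
    from nowhere_dense_powerset_window[of Y N, OF nd E this]
    obtain W s where "finite W" "W \<subseteq> Y" "W \<inter> E = {}" "s \<subseteq> W"
      and *: "\<forall>(k, e)\<in>{..n} \<times> Pow E. \<forall>A\<in>N k. A \<inter> E = e \<longrightarrow> A \<inter> W \<noteq> s"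
      by (elim exE conjE) (rule that)
    moreover have "\<forall>k\<le>n. \<forall>A\<in>N k. A \<inter> W \<noteq> s"
      using * by auto
    ultimately show ?thesis unfolding good_def by blast
  qed
  then have "\<forall>n E. \<exists>W s. finite E \<and> E \<subseteq> Y \<longrightarrow> good n E W s" by blast
  then obtain W s where Ws: "\<And>n E. finite E \<Longrightarrow> E \<subseteq> Y \<Longrightarrow> good n E (W n E) (s n E)"
    by metis
  \<comment> \<open>\<open>E n\<close> collects the windows chosen before stage \<open>n\<close>;
    avoiding it makes all windows pairwise disjoint.\<close>
  define E where "E = rec_nat {} (\<lambda>n D. D \<union> W n D)"
  have E_Suc: "E (Suc n) = E n \<union> W n (E n)" for n by (simp add: E_def)
  have E: "finite (E n) \<and> E n \<subseteq> Y" for n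
  proof (induction n)
    case (Suc n)
    then show ?case using Ws[of "E n" n] by (auto simp: E_Suc good_def)
  qed (simp add: E_def)
  define V where "V n = W n (E n)" for n
  define F where "F n = s n (E n)" for n
  have good: "good n (E n) (V n) (F n)" for n
    unfolding V_def F_def using E Ws by blast
  have "V m \<subseteq> E n" if "m < n" for m n
    using that by (induction n) (auto simp: E_Suc V_def less_Suc_eq)
  then have disj: "V m \<inter> V n = {}" if "m < n" for m n
    using good[of n] that unfolding good_def by blast
  then have disjV: "V m \<inter> V n = {}" if "m \<noteq> n" for m n
    using that by (metis Int_commute linorder_neqE_nat)
  have FV: "F n \<subseteq> V n" for n using good[of n] by (simp add: good_def)
  have pos: "A \<notin> I" if A: "A \<subseteq> Y" and inf: "infinite {n. F n \<subseteq> A}" for A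
  proof
    assume "A \<in> I"
    define B where "B = A - (\<Union>n\<in>{n. F n \<subseteq> A}. V n - F n)"
    have B: "B \<inter> V n = F n" if n: "F n \<subseteq> A" for n
    proof
      show "F n \<subseteq> B \<inter> V n"
      proof
        fix x assume x: "x \<in> F n"
        then have "x \<in> V n" using FV by blast
        then have "x \<notin> V m - F m" for m using x disjV[of m n] by (cases "m = n") auto
        then show "x \<in> B \<inter> V n" using x n \<open>x \<in> V n\<close> by (auto simp: B_def)
      qed
    qed (use n in \<open>auto simp: B_def\<close>)
    have "B \<subseteq> A" by (auto simp: B_def)
    then have "B \<in> I" using I \<open>A \<in> I\<close> unfolding ideal_on_def by meson
    then have "B \<in> restrict_ideal I Y"
      using \<open>B \<subseteq> A\<close> A by (auto simp: restrict_ideal_def)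
    then obtain k where k: "B \<in> N k" using IN by blast
    \<comment> \<open>Infinitely many blocks lie in \<open>A\<close>, so one occurs late enough for
      its pattern to exclude \<open>N k\<close>.\<close>
    obtain n where "n \<ge> k" "F n \<subseteq> A"
      using inf unfolding infinite_nat_iff_unbounded_le by blast
    then show False using good[of n] k B[of n] by (auto simp: good_def)
  qed
  show thesis
  proof (rule that[of F])
    show "finite (F n)" "F n \<subseteq> Y" for n
      using good[of n] by (auto simp: good_def intro: finite_subset)
    show "disjoint_family F"
      using disjV FV unfolding disjoint_family_on_def by blast
  qed (rule pos)
qed

section \<open>Martin's axiom\<close>

lemma partial_order_on_map_prod:
  assumes "partial_order_on P r" "inj_on f P"
  shows "partial_order_on (f ` P) (map_prod f f ` r)"
proof -
  have sub: "r \<subseteq> P \<times> P" and "refl_on P r" "trans r" "antisym r"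
    using assms(1) by (auto simp: partial_order_on_def preorder_on_def)
  have image: "\<exists>a b. x = f a \<and> y = f b \<and> (a, b) \<in> r" if "(x, y) \<in> map_prod f f ` r" for x y
    using that by auto
  have "trans (map_prod f f ` r)"
  proof (rule transI)
    fix x y z assume "(x, y) \<in> map_prod f f ` r" "(y, z) \<in> map_prod f f ` r"
    then obtain a b c d where "x = f a" "y = f b" "y = f c" "z = f d" "(a, b) \<in> r" "(c, d) \<in> r"
      using image by meson
    moreover from this have "b = c" using sub assms(2) by (auto dest: inj_onD)
    ultimately show "(x, z) \<in> map_prod f f ` r" using \<open>trans r\<close> by (force dest: transD)
  qed
  moreover have "antisym (map_prod f f ` r)"
  proof (rule antisymI)
    fix x y assume "(x, y) \<in> map_prod f f ` r" "(y, x) \<in> map_prod f f ` r"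
    then obtain a b c d where *: "x = f a" "y = f b" "y = f c" "x = f d" "(a, b) \<in> r" "(c, d) \<in> r"
      using image by meson
    moreover from this have "a \<in> P" "b \<in> P" "c \<in> P" "d \<in> P" using sub by auto
    ultimately have "a = d" "b = c" using assms(2) by (metis inj_onD)+
    then show "x = y" using * \<open>antisym r\<close> by (auto dest: antisymD)
  qed
  moreover have "refl_on (f ` P) (map_prod f f ` r)"
    using \<open>refl_on P r\<close> by (auto simp: refl_on_def intro: map_prod_imageI)
  moreover have "map_prod f f ` r \<subseteq> f ` P \<times> f ` P"
    using sub by auto
  ultimately show ?thesis
    by (simp add: partial_order_on_def preorder_on_def)
qed

text \<open>\<open>martins_axiom\<close> speaks only of posets carried by \<open>'k\<close>. An
  injection makes a copy there, transporting ccc and density forward and the filter back.\<close>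

lemma martins_axiom_poset:
  fixes \<kappa> :: "'k rel" and P :: "'p set"
  assumes MA: "martins_axiom \<kappa>" and card: "|P| \<le>o |UNIV :: 'k set|"
    and P: "P \<noteq> {}" "partial_order_on P r" "ccc P r"
    and D: "\<And>D. D \<in> \<D> \<Longrightarrow> dense_subset P r D" "|\<D>| \<le>o \<kappa>"
  obtains G where "filter_on P r G" "\<And>D. D \<in> \<D> \<Longrightarrow> G \<inter> D \<noteq> {}"
proof -
  obtain f :: "'p \<Rightarrow> 'k" where f: "inj_on f P"
    using card card_of_ordLeq[of P "UNIV :: 'k set"] by auto
  define r' where "r' = map_prod f f ` r"
  have sub: "r \<subseteq> P \<times> P"
    using P(2) by (auto simp: partial_order_on_def preorder_on_def)
  have r': "(f x, f y) \<in> r' \<longleftrightarrow> (x, y) \<in> r" if "x \<in> P" "y \<in> P" for x y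
  proof
    assume "(f x, f y) \<in> r'"
    then obtain a b where ab: "f x = f a" "f y = f b" "(a, b) \<in> r" by (auto simp: r'_def)
    then have "a \<in> P" "b \<in> P" using sub by auto
    then show "(x, y) \<in> r" using ab that f by (metis inj_onD)
  qed (force simp: r'_def)
  have compat: "compatible_in (f ` P) r' (f x) (f y) \<longleftrightarrow> compatible_in P r x y"
    if "x \<in> P" "y \<in> P" for x y
    using that r' by (auto simp: compatible_in_def)
  have "ccc (f ` P) r'"
    unfolding ccc_def
  proof safe
    fix A assume A: "forcing_antichain (f ` P) r' A"
    then obtain B where B: "A = f ` B" "B \<subseteq> P"
      unfolding forcing_antichain_def by (meson subset_image_iff)
    have "forcing_antichain P r B"
      unfolding forcing_antichain_def
    proof (intro conjI ballI impI)
      fix p q assume pq: "p \<in> B" "q \<in> B" "p \<noteq> q"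
      then have "f p \<noteq> f q" using B f by (auto dest: inj_onD)
      moreover have "f p \<in> A" "f q \<in> A" "p \<in> P" "q \<in> P" using pq B by auto
      ultimately show "\<not> compatible_in P r p q"
        using A compat unfolding forcing_antichain_def by metis
    qed (use B in auto)
    then show "countable A" using P(3) B by (auto simp: ccc_def)
  qed
  moreover have "dense_subset (f ` P) r' D'" if D': "D' \<in> image f ` \<D>" for D'
    unfolding dense_subset_def
  proof safe
    obtain D where D1: "D \<in> \<D>" "D' = f ` D" using D' by auto
    then have dD: "dense_subset P r D" using D(1) by auto
    show "x \<in> f ` P" if "x \<in> D'" for x
      using that dD D1 unfolding dense_subset_def by blast
    show "\<exists>d\<in>D'. (d, f p) \<in> r'" if "p \<in> P" for p
      using that dD D1 r' unfolding dense_subset_def by blast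
  qed
  moreover have "|image f ` \<D>| \<le>o \<kappa>"
    using D(2) card_of_image ordLeq_transitive by blast
  moreover have "partial_order_on (f ` P) r'"
    unfolding r'_def using P(2) f by (rule partial_order_on_map_prod)
  moreover have "f ` P \<noteq> {}" using P(1) by simp
  ultimately have "\<exists>G. filter_on (f ` P) r' G \<and> (\<forall>D\<in>image f ` \<D>. G \<inter> D \<noteq> {})"
    using MA unfolding martins_axiom_def by meson
  then obtain G' where G': "filter_on (f ` P) r' G'" "\<And>D. D \<in> \<D> \<Longrightarrow> G' \<inter> f ` D \<noteq> {}"
    by auto
  show thesis
  proof
    have GP: "G' \<subseteq> f ` P" using G' by (simp add: filter_on_def)
    show "filter_on P r (P \<inter> f -` G')"
      unfolding filter_on_def
    proof (intro conjI ballI impI)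
      show "P \<inter> f -` G' \<noteq> {}" using G'(1) by (fastforce simp: filter_on_def)
    next
      fix p q assume "p \<in> P \<inter> f -` G'" "q \<in> P" "(p, q) \<in> r"
      then show "q \<in> P \<inter> f -` G'" using G'(1) r'[of p q] by (auto simp: filter_on_def)
    next
      fix p q assume pq: "p \<in> P \<inter> f -` G'" "q \<in> P \<inter> f -` G'"
      then obtain s' where "s' \<in> G'" "(s', f p) \<in> r'" "(s', f q) \<in> r'"
        using G'(1) unfolding filter_on_def by blast
      then show "\<exists>s\<in>P \<inter> f -` G'. (s, p) \<in> r \<and> (s, q) \<in> r"
        using GP r' pq by blast
    qed auto
    show "P \<inter> f -` G' \<inter> D \<noteq> {}" if "D \<in> \<D>" for D
      using G'(2)[OF that] D(1)[OF that] by (auto simp: dense_subset_def)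
  qed
qed

section \<open>Almost disjoint unions\<close>

text \<open>Finite relations are read as finite partial functions \<open>i \<mapsto> p `` {i}\<close> on their
  domain. Every member of the family other than a fixed \<open>p\<close> takes at some point of the finite
  domain of \<open>p\<close> one of countably many values; deleting that point gives a family to which the
  induction hypothesis applies.\<close>

lemma countable_disagreeing_finite_relations_aux:
  fixes C :: "('i \<times> 'b :: countable) set set"
  assumes "\<And>p. p \<in> C \<Longrightarrow> finite p \<and> card (Domain p) \<le> n"
    and "\<And>p q. p \<in> C \<Longrightarrow> q \<in> C \<Longrightarrow> p \<noteq> q \<Longrightarrow> \<exists>i\<in>Domain p \<inter> Domain q. p `` {i} \<noteq> q `` {i}"
  shows "countable C"
  using assms
proof (induction n arbitrary: C)
  case 0
  have "C \<subseteq> {{}}"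
  proof
    fix p assume "p \<in> C"
    then have "Domain p = {}" using 0(1) by (metis card_0_eq finite_Domain le_zero_eq)
    then show "p \<in> {{}}" by (simp add: Domain_empty_iff)
  qed
  then show ?case by (rule countable_subset) auto
next
  case (Suc n)
  show ?case
  proof (cases "C = {}")
    case False
    then obtain p where p: "p \<in> C" by auto
    define K where "K i v = {q \<in> C. i \<in> Domain q \<and> q `` {i} = v}" for i v
    define del where "del i q = q - {i} \<times> UNIV" for i :: 'i and q :: "('i \<times> 'b) set"
    have K: "countable (K i v)" for i v
    proof -
      \<comment> \<open>On \<open>K i v\<close> the value at \<open>i\<close> is known, so deleting
        that point loses no information.\<close>
      have recover: "q = del i q \<union> {i} \<times> v" if "q \<in> K i v" for q
        using that by (auto simp: K_def del_def)
      then have inj: "inj_on (del i) (K i v)" by (metis inj_onI)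
      have "countable (del i ` K i v)"
      proof (rule Suc.IH)
        fix q' assume "q' \<in> del i ` K i v"
        then obtain q where q: "q' = del i q" "q \<in> C" "i \<in> Domain q" by (auto simp: K_def)
        have "finite (Domain q)" "card (Domain q) \<le> Suc n"
          using Suc.prems(1)[OF q(2)] by (auto simp: finite_Domain)
        moreover have "Domain q' = Domain q - {i}" using q by (auto simp: del_def)
        ultimately show "finite q' \<and> card (Domain q') \<le> n"
          using Suc.prems(1)[OF q(2)] q by (auto simp: del_def)
      next
        fix q1' q2' assume "q1' \<in> del i ` K i v" "q2' \<in> del i ` K i v" and ne: "q1' \<noteq> q2'"
        then obtain q1 q2 where q: "q1' = del i q1" "q2' = del i q2" "q1 \<in> K i v" "q2 \<in> K i v"
          by auto
        then obtain j where j: "j \<in> Domain q1 \<inter> Domain q2" "q1 `` {j} \<noteq> q2 `` {j}"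
          using Suc.prems(2)[of q1 q2] ne by (auto simp: K_def)
        \<comment> \<open>Members of \<open>K i v\<close> agree at \<open>i\<close>, so their
          disagreement is elsewhere and survives the deletion.\<close>
        have "j \<noteq> i" using j(2) q by (auto simp: K_def)
        then have "j \<in> Domain q1' \<inter> Domain q2'" "q1' `` {j} = q1 `` {j}" "q2' `` {j} = q2 `` {j}"
          using j(1) q by (auto simp: del_def)
        then show "\<exists>j\<in>Domain q1' \<inter> Domain q2'. q1' `` {j} \<noteq> q2' `` {j}"
          using j(2) by auto
      qed
      then show ?thesis using inj countable_image_inj_on by blast
    qed
    have fin: "finite (q `` {i})" if "q \<in> C" for q i
      using Suc.prems(1)[OF that] by (simp add: finite_Image)
    \<comment> \<open>The values are finite subsets of a countable type, so this union is
      countable.\<close>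
    have "C \<subseteq> insert p (\<Union>i\<in>Domain p. \<Union>v\<in>Collect finite. K i v)"
    proof
      fix q assume q: "q \<in> C"
      show "q \<in> insert p (\<Union>i\<in>Domain p. \<Union>v\<in>Collect finite. K i v)"
        using Suc.prems(2)[OF p q] q fin[OF q] by (auto simp: K_def)
    qed
    moreover have "countable (Domain p)"
      using Suc.prems(1)[OF p] by (auto simp: finite_Domain intro: countable_finite)
    moreover have "countable (Collect finite :: 'b set set)"
      by (rule countable_Collect_finite)
    ultimately show ?thesis
      using K by (elim countable_subset) auto
  qed simp
qed

text \<open>Splitting by the size of the domain yields countably many classes, each covered by the
  bounded case. This replaces a Delta-system argument in the proof of ccc.\<close>

lemma countable_disagreeing_finite_relations:
  fixes C :: "('i \<times> 'b :: countable) set set"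
  assumes fin: "\<And>p. p \<in> C \<Longrightarrow> finite p"
    and dis: "\<And>p q. p \<in> C \<Longrightarrow> q \<in> C \<Longrightarrow> p \<noteq> q \<Longrightarrow> \<exists>i\<in>Domain p \<inter> Domain q. p `` {i} \<noteq> q `` {i}"
  shows "countable C"
proof -
  have "countable {p \<in> C. card (Domain p) \<le> n}" for n
    by (rule countable_disagreeing_finite_relations_aux[of _ n]) (use fin dis in auto)
  moreover have "C = (\<Union>n. {p \<in> C. card (Domain p) \<le> n})" by auto
  ultimately show ?thesis by (metis (lifting) countable_UN[OF countableI_type])
qed

section \<open>The poset of finite approximations\<close>

definition chosen_union :: "('i \<Rightarrow> nat \<Rightarrow> 'a set) \<Rightarrow> ('i \<times> nat) set \<Rightarrow> 'i \<Rightarrow> 'a set" where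
  "chosen_union F p i = (\<Union>n\<in>p `` {i}. F i n)"

text \<open>A condition \<open>p\<close> decides finitely many of the indices \<open>n\<close> for which \<open>F i n\<close> goes
  into the \<open>i\<close>-th set, and promises that the sets in its domain acquire no new common points.\<close>

definition adr_order :: "('i \<Rightarrow> nat \<Rightarrow> 'a set) \<Rightarrow> 'i set \<Rightarrow> ('i \<times> nat) set rel" where
  "adr_order F J = {(q, p). q \<in> Fpow (J \<times> UNIV) \<and> p \<in> Fpow (J \<times> UNIV) \<and> p \<subseteq> q \<and>
     (\<forall>i\<in>Domain p. \<forall>j\<in>Domain p. i \<noteq> j \<longrightarrow>
       chosen_union F q i \<inter> chosen_union F q j \<subseteq> chosen_union F p i \<inter> chosen_union F p j)}"

lemma chosen_union_mono: "p \<subseteq> q \<Longrightarrow> chosen_union F p i \<subseteq> chosen_union F q i"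
  by (auto simp: chosen_union_def)

lemma finite_chosen_union:
  assumes "finite p" "\<And>n. finite (F i n)"
  shows "finite (chosen_union F p i)"
  using assms by (auto simp: chosen_union_def)

lemma partial_order_adr_order: "partial_order_on (Fpow (J \<times> UNIV)) (adr_order F J)"
proof -
  have "trans (adr_order F J)"
  proof (rule transI)
    fix x y z assume xy: "(x, y) \<in> adr_order F J" and yz: "(y, z) \<in> adr_order F J"
    \<comment> \<open>Every pair of indices named by \<open>z\<close> is also named by
      \<open>y\<close>, so the promise of \<open>y\<close> can be chained with that of
      \<open>z\<close>.\<close>
    have "Domain z \<subseteq> Domain y" using yz by (auto simp: adr_order_def)
    then have "chosen_union F x i \<inter> chosen_union F x j \<subseteq> chosen_union F z i \<inter> chosen_union F z j"
      if "i \<in> Domain z" "j \<in> Domain z" "i \<noteq> j" for i j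
      using that xy yz unfolding adr_order_def by (blast dest!: subsetD)
    then show "(x, z) \<in> adr_order F J"
      using xy yz by (auto simp: adr_order_def)
  qed
  then show ?thesis
    by (auto simp: partial_order_on_def preorder_on_def refl_on_def adr_order_def antisym_def)
qed

text \<open>The union changes no value on \<open>Domain p\<close>; new values appear only at indices
  about which \<open>p\<close> has promised nothing.\<close>

lemma adr_order_Un:
  assumes p: "p \<in> Fpow (J \<times> UNIV)" and q: "q \<in> Fpow (J \<times> UNIV)"
    and agree: "\<And>i. i \<in> Domain p \<Longrightarrow> i \<in> Domain q \<Longrightarrow> p `` {i} = q `` {i}"
  shows "(p \<union> q, p) \<in> adr_order F J"
proof -
  have "(p \<union> q) `` {i} = p `` {i}" if "i \<in> Domain p" for i
    using agree[OF that] by (cases "i \<in> Domain q") auto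
  then have "chosen_union F (p \<union> q) i = chosen_union F p i" if "i \<in> Domain p" for i
    using that by (simp add: chosen_union_def)
  then show ?thesis using p q by (auto simp: adr_order_def Fpow_def)
qed

text \<open>If two conditions agree on their common domain, their union lies below both. Members of
  an antichain therefore disagree pairwise at common indices, which forces countability whatever the
  size of \<open>J\<close>.\<close>

lemma ccc_adr_order: "ccc (Fpow (J \<times> UNIV)) (adr_order F J)"
  unfolding ccc_def
proof safe
  fix A assume A: "forcing_antichain (Fpow (J \<times> UNIV)) (adr_order F J) A"
  show "countable A"
  proof (rule countable_disagreeing_finite_relations)
    show "finite p" if "p \<in> A" for p
      using A that by (auto simp: forcing_antichain_def Fpow_def)
    fix p q assume pq: "p \<in> A" "q \<in> A" "p \<noteq> q"
    show "\<exists>i\<in>Domain p \<inter> Domain q. p `` {i} \<noteq> q `` {i}"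
    proof (rule ccontr)
      assume "\<not> ?thesis"
      then have agree: "\<And>i. i \<in> Domain p \<Longrightarrow> i \<in> Domain q \<Longrightarrow> p `` {i} = q `` {i}" by auto
      have P: "p \<in> Fpow (J \<times> UNIV)" "q \<in> Fpow (J \<times> UNIV)"
        using A pq by (auto simp: forcing_antichain_def)
      have "(p \<union> q, p) \<in> adr_order F J" "(q \<union> p, q) \<in> adr_order F J"
        using adr_order_Un[of p J q F] adr_order_Un[of q J p F] P agree by auto
      then have "compatible_in (Fpow (J \<times> UNIV)) (adr_order F J) p q"
        unfolding compatible_in_def by (metis P Un_commute Fpow_def Un_least finite_UnI mem_Collect_eq)
      then show False using A pq by (auto simp: forcing_antichain_def)
    qed
  qed
qed

text \<open>Only finitely many points are in use by \<open>p\<close>, and each lies in at most one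
  \<open>F i n\<close>. Hence all sufficiently late blocks avoid these points, and adding one
  creates no new common point.\<close>

lemma dense_adr_order:
  assumes i: "i \<in> J" and fin: "\<And>j n. j \<in> J \<Longrightarrow> finite (F j n)" and disj: "disjoint_family (F i)"
  shows "dense_subset (Fpow (J \<times> UNIV)) (adr_order F J)
           {p \<in> Fpow (J \<times> UNIV). \<exists>n\<ge>m. (i, n) \<in> p}"
  unfolding dense_subset_def
proof (intro conjI ballI)
  fix p assume p: "p \<in> Fpow (J \<times> (UNIV :: nat set))"
  define Z where "Z = (\<Union>j\<in>Domain p. chosen_union F p j)"
  have "finite p" "Domain p \<subseteq> J" using p by (auto simp: Fpow_def)
  then have "finite Z"
    unfolding Z_def by (intro finite_UN_I finite_Domain finite_chosen_union fin) auto
  moreover have "finite {n. z \<in> F i n}" for z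
  proof -
    have "m = n" if "z \<in> F i m" "z \<in> F i n" for m n
      using disj that unfolding disjoint_family_on_def by blast
    then have "{n. z \<in> F i n} = {} \<or> (\<exists>n. {n. z \<in> F i n} = {n})" by blast
    then show ?thesis by auto
  qed
  ultimately have "finite (\<Union>z\<in>Z. {n. z \<in> F i n})" by blast
  moreover have "{n. F i n \<inter> Z \<noteq> {}} = (\<Union>z\<in>Z. {n. z \<in> F i n})" by auto
  ultimately have "finite {n. F i n \<inter> Z \<noteq> {}}" by simp
  then obtain b where b: "\<And>n. F i n \<inter> Z \<noteq> {} \<Longrightarrow> n < b"
    by (metis (mono_tags, lifting) finite_nat_set_iff_bounded mem_Collect_eq)
  \<comment> \<open>\<open>b\<close> bounds the indices of blocks meeting \<open>Z\<close>, while
    \<open>m\<close> is the lower bound demanded by the dense set.\<close>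
  define n where "n = max m b"
  define q where "q = insert (i, n) p"
  have FZ: "F i n \<inter> Z = {}" using b[of n] by (auto simp: n_def)
  have tr: "chosen_union F q j = (if j = i then F i n \<union> chosen_union F p i else chosen_union F p j)" for j
    by (auto simp: q_def chosen_union_def)
  have "chosen_union F q j \<inter> chosen_union F q k \<subseteq> chosen_union F p j \<inter> chosen_union F p k"
    if "j \<in> Domain p" "k \<in> Domain p" "j \<noteq> k" for j k
    using that FZ unfolding tr Z_def by auto
  then have "(q, p) \<in> adr_order F J" "q \<in> Fpow (J \<times> UNIV)"
    using p i by (auto simp: adr_order_def q_def Fpow_def)
  moreover have "n \<ge> m" "(i, n) \<in> q" by (auto simp: n_def q_def)
  ultimately show "\<exists>d\<in>{p \<in> Fpow (J \<times> UNIV). \<exists>n\<ge>m. (i, n) \<in> p}. (d, p) \<in> adr_order F J"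
    by blast
qed auto

section \<open>Cardinality bounds and the generic family\<close>

lemma card_of_Times_nat_ordLeq:
  assumes "Cinfinite \<kappa>" "|J| \<le>o \<kappa>"
  shows "|J \<times> (UNIV :: nat set)| \<le>o \<kappa>"
proof -
  have Card: "Card_order \<kappa>" and inf: "infinite (Field \<kappa>)"
    using assms(1) by (auto simp: cinfinite_def)
  have "|UNIV :: nat set| \<le>o \<kappa>"
    using inf Card infinite_iff_card_of_nat card_of_Field_ordIso ordLeq_ordIso_trans by blast
  then show ?thesis
    using card_of_Times_ordLeq_infinite_Field[OF inf assms(2)] Card by blast
qed

lemma card_of_Fpow_ordLeq:
  assumes "infinite B" "|A| \<le>o |B|"
  shows "|Fpow A| \<le>o |B|"
proof (cases "finite A")
  case True
  then have "finite (Fpow A)" by (simp add: Fpow_Pow_finite)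
  then show ?thesis using assms(1) by (meson card_of_Well_order finite_ordLess_infinite2 ordLess_imp_ordLeq)
next
  case False
  then show ?thesis using assms(2) eqpoll_Fpow[OF False]
    by (metis card_of_ordIso eqpoll_def ordIso_ordLeq_trans)
qed

text \<open>Density makes every generic \<open>S i\<close> unbounded. Once one condition of the
  filter mentions both \<open>i\<close> and \<open>j\<close>, its promise freezes the intersection
  of the two unions inside a finite set.\<close>

theorem martins_axiom_almost_disjoint_unions:
  fixes \<kappa> :: "'k rel" and F :: "'i \<Rightarrow> nat \<Rightarrow> 'a set"
  assumes \<kappa>: "Cinfinite \<kappa>" and MA: "martins_axiom \<kappa>" and J: "|J| \<le>o \<kappa>"
    and fin: "\<And>i n. i \<in> J \<Longrightarrow> finite (F i n)" and disj: "\<And>i. i \<in> J \<Longrightarrow> disjoint_family (F i)"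
  obtains S where "\<And>i. i \<in> J \<Longrightarrow> infinite (S i)"
    "\<And>i j. i \<in> J \<Longrightarrow> j \<in> J \<Longrightarrow> i \<noteq> j \<Longrightarrow> finite ((\<Union>n\<in>S i. F i n) \<inter> (\<Union>n\<in>S j. F j n))"
proof -
  let ?P = "Fpow (J \<times> (UNIV :: nat set))"
  let ?r = "adr_order F J"
  let ?D = "\<lambda>(i, m). {p \<in> ?P. \<exists>n\<ge>m. (i, n) \<in> p}"
  have JN: "|J \<times> (UNIV :: nat set)| \<le>o \<kappa>"
    using \<kappa> J by (rule card_of_Times_nat_ordLeq)
  \<comment> \<open>The conditions have to fit into \<open>'k\<close>, which contains
    \<open>Field \<kappa>\<close>; the bound by \<kappa> itself is applied to the family of dense
    sets.\<close>
  have "\<kappa> \<le>o |Field \<kappa>|"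
    using \<kappa> card_of_Field_ordIso ordIso_iff_ordLeq by blast
  then have "|J \<times> (UNIV :: nat set)| \<le>o |UNIV :: 'k set|"
    using JN by (meson card_of_mono1 ordLeq_transitive subset_UNIV)
  moreover have "infinite (UNIV :: 'k set)"
    using \<kappa> by (meson cinfinite_def infinite_super subset_UNIV)
  ultimately have card: "|?P| \<le>o |UNIV :: 'k set|" by (intro card_of_Fpow_ordLeq)
  have dense: "dense_subset ?P ?r D" if "D \<in> ?D ` (J \<times> UNIV)" for D
    using that dense_adr_order[of _ J F] fin disj by auto
  have "|?D ` (J \<times> UNIV)| \<le>o \<kappa>"
    using JN card_of_image ordLeq_transitive by blast
  with dense obtain G where
    G: "filter_on ?P ?r G" "\<And>D. D \<in> ?D ` (J \<times> UNIV) \<Longrightarrow> G \<inter> D \<noteq> {}"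
    using martins_axiom_poset[OF MA card Fpow_not_empty partial_order_adr_order ccc_adr_order,
        of "?D ` (J \<times> UNIV)" F]
    by blast
  have lower: "\<exists>s\<in>G. (s, p) \<in> ?r \<and> (s, q) \<in> ?r" if "p \<in> G" "q \<in> G" for p q
    using G(1) that by (simp add: filter_on_def)
  have subset: "p \<subseteq> s" if "(s, p) \<in> ?r" for s p
    using that by (simp add: adr_order_def)
  define S where "S i = \<Union>G `` {i}" for i
  have hit: "\<exists>p\<in>G. \<exists>n\<ge>m. (i, n) \<in> p" if "i \<in> J" for i m
    using G(2)[of "?D (i, m)"] that by auto
  show thesis
  proof
    fix i assume "i \<in> J"
    then show "infinite (S i)"
      unfolding S_def infinite_nat_iff_unbounded_le using hit by blast
  next
    fix i j assume ij: "i \<in> J" "j \<in> J" "i \<noteq> j"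
    obtain p0 p1 where p01: "p0 \<in> G" "p1 \<in> G" "i \<in> Domain p0" "j \<in> Domain p1"
      using hit[OF ij(1)] hit[OF ij(2)] by blast
    obtain p where "p \<in> G" "p0 \<subseteq> p" "p1 \<subseteq> p"
      using lower[OF p01(1,2)] subset by blast
    then have p: "p \<in> G" "i \<in> Domain p" "j \<in> Domain p" using p01 by auto
    have "x \<in> chosen_union F p i" if x: "x \<in> (\<Union>n\<in>S i. F i n) \<inter> (\<Union>n\<in>S j. F j n)" for x
    proof -
      obtain q0 q1 where q: "q0 \<in> G" "q1 \<in> G" "x \<in> chosen_union F q0 i" "x \<in> chosen_union F q1 j"
        using x unfolding S_def chosen_union_def by blast
      obtain q where "q \<in> G" "q0 \<subseteq> q" "q1 \<subseteq> q"
        using lower[OF q(1,2)] subset by blast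
      \<comment> \<open>Being below both, \<open>s\<close> contains the choices that put
        \<open>x\<close> into the two unions and still obeys the promise of
        \<open>p\<close>.\<close>
      moreover obtain s where "(s, p) \<in> ?r" "(s, q) \<in> ?r"
        using lower[OF p(1) \<open>q \<in> G\<close>] by blast
      ultimately have "q0 \<subseteq> s" "q1 \<subseteq> s"
        using subset by blast+
      then have "x \<in> chosen_union F s i \<inter> chosen_union F s j"
        using q(3,4) chosen_union_mono[of q0 s F i] chosen_union_mono[of q1 s F j] by auto
      moreover have "chosen_union F s i \<inter> chosen_union F s j \<subseteq> chosen_union F p i"
        using \<open>(s, p) \<in> ?r\<close> p ij(3) by (simp add: adr_order_def)
      ultimately show ?thesis by blast
    qed
    moreover have "finite p"
      using p G(1) by (auto simp: filter_on_def Fpow_def)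
    then have "finite (chosen_union F p i)"
      using fin[OF ij(1)] by (rule finite_chosen_union)
    ultimately show "finite ((\<Union>n\<in>S i. F i n) \<inter> (\<Union>n\<in>S j. F j n))"
      by (meson finite_subset subsetI)
  qed
qed

section \<open>From almost disjoint unions to almost disjoint refinements\<close>

theorem theorem1p12:
  fixes \<kappa> :: "'k rel" and I :: "nat set set" and \<H> :: "nat set set"
  assumes "Cinfinite \<kappa>"
    and "martins_axiom \<kappa>"
    and "ideal_on UNIV I"
    and "everywhere_meager UNIV I"
    and "\<H> \<subseteq> positive_sets UNIV I"
    and "|\<H>| \<le>o \<kappa>"
  shows "\<exists>A. Fin_ADR UNIV I \<H> A"
proof -
  have "\<exists>F :: nat \<Rightarrow> nat set. (\<forall>n. finite (F n) \<and> F n \<subseteq> H) \<and> disjoint_family F \<and>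
          (\<forall>A\<subseteq>H. infinite {n. F n \<subseteq> A} \<longrightarrow> A \<notin> I)" if "H \<in> \<H>" for H
  proof -
    have "meager_in (powerset_topology H) (restrict_ideal I H)"
      using assms(4,5) that by (auto simp: everywhere_meager_def)
    from meager_ideal_disjoint_finite_sets[OF assms(3) this] show ?thesis by metis
  qed
  then obtain F :: "nat set \<Rightarrow> nat \<Rightarrow> nat set" where
    F: "\<And>H n. H \<in> \<H> \<Longrightarrow> finite (F H n)" "\<And>H n. H \<in> \<H> \<Longrightarrow> F H n \<subseteq> H"
       "\<And>H. H \<in> \<H> \<Longrightarrow> disjoint_family (F H)"
       "\<And>H A. H \<in> \<H> \<Longrightarrow> A \<subseteq> H \<Longrightarrow> infinite {n. F H n \<subseteq> A} \<Longrightarrow> A \<notin> I"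
    by metis
  obtain S where S: "\<And>H. H \<in> \<H> \<Longrightarrow> infinite (S H)"
    "\<And>H K. H \<in> \<H> \<Longrightarrow> K \<in> \<H> \<Longrightarrow> H \<noteq> K \<Longrightarrow> finite ((\<Union>n\<in>S H. F H n) \<inter> (\<Union>n\<in>S K. F K n))"
    using martins_axiom_almost_disjoint_unions[OF assms(1,2,6), of F] F(1,3) by metis
  have "(\<Union>n\<in>S H. F H n) \<subseteq> H \<and> (\<Union>n\<in>S H. F H n) \<notin> I" if H: "H \<in> \<H>" for H
  proof
    show sub: "(\<Union>n\<in>S H. F H n) \<subseteq> H" using F(2)[OF H] by auto
    \<comment> \<open>Every chosen block lies in the union, so infinitude of \<open>S H\<close> is
      exactly what the positivity criterion for \<open>F H\<close> asks for.\<close>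
    have "S H \<subseteq> {n. F H n \<subseteq> (\<Union>n\<in>S H. F H n)}" by auto
    then have "infinite {n. F H n \<subseteq> (\<Union>n\<in>S H. F H n)}"
      using S(1)[OF H] infinite_super by blast
    then show "(\<Union>n\<in>S H. F H n) \<notin> I" using F(4)[OF H sub] by blast
  qed
  then show ?thesis
    using S(2) unfolding Fin_ADR_def positive_sets_def
    by (intro exI[of _ "\<lambda>H. \<Union>n\<in>S H. F H n"]) auto
qed

end
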